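(* Let $t>0$, let $\mathbf{P}=(P_1,P_2,P_3)$ be a non-degenerate triangle in the plane, and let $\mathbf{Q}=q_t(\mathbf{P})$, $\mathbf{R}=r_t(\mathbf{P})$ (so that $\mathbf{Q}\stackrel{t}{\sim}\mathbf{R}$). Then the triangles $\mathbf{Q}$ and $\mathbf{R}$ are inscribed into a conic and circumscribed about a conic: the six points $Q_1,Q_2,Q_3,R_1,R_2,R_3$ lie on one conic, and the six lines $Q_1Q_2,Q_2Q_3,Q_3Q_1,R_1R_2,R_2R_3,R_3R_1$ are tangent to one conic. Furthermore, set $$L_1=R_1R_2\cap Q_3Q_1,\quad L_2=R_2R_3\cap Q_1Q_2,\quad L_3=R_3R_1\cap Q_2Q_3,$$ $$M_1=R_2R_3\cap Q_2Q_3,\quad M_2=R_3R_1\cap Q_3Q_1,\quad M_3=R_1R_2\cap Q_1Q_2.$$ Then the triples of points $L_1,P_1,M_1$; $L_2,P_2,M_2$; and $L_3,P_3,M_3$ are collinear, and the three lines $L_1P_1$, $L_2P_2$, $L_3P_3$ are concurrent.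
   Context: Indices are cyclic mod 3. For a triangle $\mathbf{P}=(P_1,P_2,P_3)$ and $t>0$, $q_t(\mathbf{P})=(Q_1,Q_2,Q_3)$ and $r_t(\mathbf{P})=(R_1,R_2,R_3)$ are given by $$Q_i=P_i+t\frac{P_i-P_{i-1}}{|P_i-P_{i-1}|},\qquad R_i=P_i+t\frac{P_i-P_{i+1}}{|P_i-P_{i+1}|}.$$ One writes $\mathbf{Q}\stackrel{t}{\sim}\mathbf{R}$ if $\mathbf{Q}=q_t(\mathbf{P})$ and $\mathbf{R}=r_t(\mathbf{P})$ for some triangle $\mathbf{P}$. Here $XY$ denotes the line through $X$ and $Y$. Intersections, collinearity, concurrency and tangency are understood in the real projective plane. *)

theory Defs
  imports "HOL-Analysis.Analysis"
begin

text \<open>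
  Triangles are indexed by the three-element type \<open>3\<close>, whose arithmetic is modulo 3
  (so \<open>3 = 0\<close>, \<open>3 + 1 = 1\<close> and \<open>1 - 1 = 3\<close>).
\<close>

definition q_map :: "real \<Rightarrow> (3 \<Rightarrow> real^2) \<Rightarrow> 3 \<Rightarrow> real^2"
  where "q_map t P i = P i + (t / norm (P i - P (i - 1))) *\<^sub>R (P i - P (i - 1))"

definition r_map :: "real \<Rightarrow> (3 \<Rightarrow> real^2) \<Rightarrow> 3 \<Rightarrow> real^2"
  where "r_map t P i = P i + (t / norm (P i - P (i + 1))) *\<^sub>R (P i - P (i + 1))"

text \<open>
  The real projective plane: points and lines are the linear subspaces of \<open>real^3\<close> of
  dimension 1 and 2, and incidence is inclusion. Consequently the line through two distinct points
  is the span of their union, and the common point of two distinct lines is their intersection.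
\<close>

definition proj_point :: "(real^3) set \<Rightarrow> bool"
  where "proj_point p \<longleftrightarrow> subspace p \<and> dim p = 1"

definition proj_line :: "(real^3) set \<Rightarrow> bool"
  where "proj_line l \<longleftrightarrow> subspace l \<and> dim l = 2"

definition proj_of :: "real^2 \<Rightarrow> (real^3) set"
  where "proj_of x = span {vector [x $ 1, x $ 2, 1]}"

definition line_through :: "(real^3) set \<Rightarrow> (real^3) set \<Rightarrow> (real^3) set"
  where "line_through p q = span (p \<union> q)"

text \<open>
  In the next two definitions the arguments are required to be actual points and lines, so that
  asserting collinearity or concurrency includes that the points and lines involved are well defined.
\<close>

definition proj_collinear :: "(real^3) set \<Rightarrow> (real^3) set \<Rightarrow> (real^3) set \<Rightarrow> bool"
  where "proj_collinear p q r \<longleftrightarrow> proj_point p \<and> proj_point q \<and> proj_point r \<and>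
    (\<exists>l. proj_line l \<and> p \<subseteq> l \<and> q \<subseteq> l \<and> r \<subseteq> l)"

definition proj_concurrent :: "(real^3) set \<Rightarrow> (real^3) set \<Rightarrow> (real^3) set \<Rightarrow> bool"
  where "proj_concurrent a b c \<longleftrightarrow> proj_line a \<and> proj_line b \<and> proj_line c \<and>
    (\<exists>p. proj_point p \<and> p \<subseteq> a \<and> p \<subseteq> b \<and> p \<subseteq> c)"

definition conic_points :: "real^3^3 \<Rightarrow> (real^3) set set"
  where "conic_points A = {p. proj_point p \<and> (\<forall>v\<in>p. v \<bullet> (A *v v) = 0)}"

text \<open>
  Conics are non-degenerate and have a real point; they are given by the matrix of a quadratic form,
  which is unique up to a scalar factor.
\<close>

definition conic_matrix :: "real^3^3 \<Rightarrow> bool"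
  where "conic_matrix A \<longleftrightarrow> transpose A = A \<and> invertible A \<and> conic_points A \<noteq> {}"

text \<open>
  The gradient of the quadratic form at \<open>u\<close> is \<open>2 *\<^sub>R (A *v u)\<close>, so for symmetric \<open>A\<close> the
  tangent line at the point spanned by \<open>u\<close> is \<open>{v. u \<bullet> (A *v v) = 0}\<close>.
\<close>

definition tangent_line_at :: "real^3^3 \<Rightarrow> (real^3) set \<Rightarrow> (real^3) set"
  where "tangent_line_at A p = {v. \<forall>u\<in>p. u \<bullet> (A *v v) = 0}"

definition tangent_to_conic :: "(real^3) set \<Rightarrow> real^3^3 \<Rightarrow> bool"
  where "tangent_to_conic l A \<longleftrightarrow> (\<exists>p\<in>conic_points A. l = tangent_line_at A p)"

end

theory Submission
  imports Defs
begin

text \<open>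
  Work in barycentric coordinates with respect to the triangle, with \<open>u, v, w\<close> equal to
  \<open>1 + a / t, 1 + b / t, 1 + c / t\<close> for the side lengths \<open>a, b, c\<close>. Then \<open>Q\<close> and \<open>R\<close> become
  \<open>(v, 0, -1), (-1, w, 0), (0, -1, u)\<close> and \<open>(w, -1, 0), (0, u, -1), (-1, 0, v)\<close>, and everything can
  be written down explicitly: both conics, the points \<open>L\<^sub>i\<close> and \<open>M\<^sub>i\<close>, and the point of concurrency,
  which is \<open>(v * w - u, u * w - v, u * v - w)\<close>. The triangle inequality makes these three
  coordinates positive, and together with \<open>u, v, w > 1\<close> this excludes every degeneracy. A linear
  isomorphism of \<open>real^3\<close> carries the configuration back to the original coordinates.
\<close>

section \<open>Coordinates and cross products in \<open>real^3\<close>\<close>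

lemma inner_transpose_matrix: "(transpose A *v x) \<bullet> y = x \<bullet> ((A::real^'n^'m) *v y)"
  by (simp add: dot_lmul_matrix)

lemma vector_3_cases:
  obtains a b c where "(x::real^3) = vector [a, b, c]"
  using forall_vector_3[of "\<lambda>y. y = x \<longrightarrow> (\<exists>a b c. y = vector [a, b, c])"] by blast

lemma vector_3_eq_iff: "(vector [a, b, c] :: real^3) = vector [a', b', c'] \<longleftrightarrow> a = a' \<and> b = b' \<and> c = c'"
  by (simp add: vec_eq_iff forall_3)

lemma vector_3_eq_0_iff: "(vector [a, b, c] :: real^3) = 0 \<longleftrightarrow> a = 0 \<and> b = 0 \<and> c = 0"
  by (simp add: vec_eq_iff forall_3)

lemma inner_vector_3: "(vector [a, b, c] :: real^3) \<bullet> vector [a', b', c'] = a * a' + b * b' + c * c'"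
  by (simp add: inner_vec_def sum_3)

lemma vector_3_plus:
  "(vector [a, b, c] :: real^3) + vector [a', b', c'] = vector [a + a', b + b', c + c']"
  by (simp add: vec_eq_iff forall_3)

lemma vector_3_minus:
  "(vector [a, b, c] :: real^3) - vector [a', b', c'] = vector [a - a', b - b', c - c']"
  by (simp add: vec_eq_iff forall_3)

lemma scaleR_vector_3: "k *\<^sub>R (vector [a, b, c] :: real^3) = vector [k * a, k * b, k * c]"
  by (simp add: vec_eq_iff forall_3)

lemma cross3_vector:
  "cross3 (vector [a, b, c]) (vector [d, e, f]) = vector [b * f - c * e, c * d - a * f, a * e - b * d]"
  by (simp add: cross3_def)

lemma matrix_vector_mult_vector_3:
  "(vector [vector [a, b, c], vector [d, e, f], vector [g, h, i]] :: real^3^3) *v vector [x, y, z] =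
    vector [a * x + b * y + c * z, d * x + e * y + f * z, g * x + h * y + i * z]"
  by (simp add: vec_eq_iff forall_3 matrix_vector_mult_def sum_3)

lemmas vector_3_simps =
  vector_3_eq_iff vector_3_eq_0_iff inner_vector_3 vector_3_plus vector_3_minus scaleR_vector_3 cross3_vector
  matrix_vector_mult_vector_3

text \<open>Cramer's rule in the basis \<open>x, y, n\<close>, whose determinant is
  \<open>n \<bullet> n\<close>. Multiplying through by this determinant keeps the identity
  polynomial.\<close>

lemma cross3_cramer:
  fixes x y z :: "real^3"
  defines "n \<equiv> cross3 x y"
  shows "(n \<bullet> n) *\<^sub>R z = (cross3 z y \<bullet> n) *\<^sub>R x + (cross3 x z \<bullet> n) *\<^sub>R y + (n \<bullet> z) *\<^sub>R n"
  unfolding n_def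
  by (cases x rule: vector_3_cases, cases y rule: vector_3_cases, cases z rule: vector_3_cases)
    (simp add: vector_3_simps algebra_simps)

text \<open>For \<open>z\<close> orthogonal to the cross product, the last term of
  \<open>cross3_cramer\<close> vanishes and a combination of \<open>x\<close> and \<open>y\<close>
  remains. Joins of points thus become explicit normal vectors.\<close>

lemma span_pair_eq_hyperplane:
  fixes x y :: "real^3"
  assumes "cross3 x y \<noteq> 0"
  shows "span {x, y} = {z. cross3 x y \<bullet> z = 0}"
proof
  show "span {x, y} \<subseteq> {z. cross3 x y \<bullet> z = 0}"
    by (rule span_minimal) (auto simp: subspace_hyperplane dot_cross_self)
  show "{z. cross3 x y \<bullet> z = 0} \<subseteq> span {x, y}"
  proof
    fix z assume "z \<in> {z. cross3 x y \<bullet> z = 0}"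
    then have "(cross3 x y \<bullet> cross3 x y) *\<^sub>R z \<in> span {x, y}"
      by (subst cross3_cramer) (auto intro!: span_add span_scale simp: span_base)
    then show "z \<in> span {x, y}"
      using assms span_scale[of "(cross3 x y \<bullet> cross3 x y) *\<^sub>R z" _ "inverse (cross3 x y \<bullet> cross3 x y)"]
      by simp
  qed
qed

text \<open>By the expansion of the triple product, a vector orthogonal to both normals has zero
  cross product with \<open>cross3 m n\<close>, so it is a multiple of it. This computes the meet of
  two lines.\<close>

lemma hyperplane_Int_eq_span_cross3:
  fixes m n :: "real^3"
  assumes "cross3 m n \<noteq> 0"
  shows "{z. m \<bullet> z = 0} \<inter> {z. n \<bullet> z = 0} = span {cross3 m n}"
proof
  show "span {cross3 m n} \<subseteq> {z. m \<bullet> z = 0} \<inter> {z. n \<bullet> z = 0}"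
    by (auto simp: span_singleton dot_cross_self)
  show "{z. m \<bullet> z = 0} \<inter> {z. n \<bullet> z = 0} \<subseteq> span {cross3 m n}"
  proof
    fix z assume "z \<in> {z. m \<bullet> z = 0} \<inter> {z. n \<bullet> z = 0}"
    then have "cross3 (cross3 m n) z = 0"
      by (simp add: Lagrange inner_commute cross_skew[of "cross3 m n"])
    then have "collinear {0, cross3 m n, z}"
      by (simp add: cross_eq_0)
    then obtain c where "z = c *\<^sub>R cross3 m n"
      using assms by (auto simp: collinear_lemma)
    then show "z \<in> span {cross3 m n}"
      by (simp add: span_scale span_base)
  qed
qed

section \<open>Points, lines and conics in homogeneous coordinates\<close>

lemma line_through_span: "line_through (span A) (span B) = span (A \<union> B)"
  by (simp add: line_through_def span_Un span_span)

lemma proj_point_span: "x \<noteq> 0 \<Longrightarrow> proj_point (span {x})"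
  by (simp add: proj_point_def subspace_span dim_span dim_singleton)

lemma proj_line_hyperplane: "n \<noteq> 0 \<Longrightarrow> proj_line {z. n \<bullet> z = 0}"
  by (simp add: proj_line_def subspace_hyperplane dim_hyperplane)

lemma span_in_conic_points:
  "x \<noteq> 0 \<Longrightarrow> x \<bullet> (A *v x) = 0 \<Longrightarrow> span {x} \<in> conic_points A"
  using proj_point_span[of x]
  by (auto simp: conic_points_def span_singleton matrix_vector_mult_scaleR)

lemma tangent_line_at_span: "tangent_line_at A (span {x}) = {v. x \<bullet> (A *v v) = 0}"
  by (auto simp: tangent_line_at_def span_singleton dest: spec[of _ 1])

lemma line_through_span_pair:
  "cross3 x y \<noteq> 0 \<Longrightarrow> line_through (span {x}) (span {y}) = {z. cross3 x y \<bullet> z = 0}"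
  by (simp add: line_through_span insert_commute flip: span_pair_eq_hyperplane)

lemma proj_collinear_span:
  assumes "x \<noteq> 0" "y \<noteq> 0" "z \<noteq> 0" "n \<noteq> 0" "n \<bullet> x = 0" "n \<bullet> y = 0" "n \<bullet> z = 0"
  shows "proj_collinear (span {x}) (span {y}) (span {z})"
  unfolding proj_collinear_def using assms
  by (auto simp: proj_point_span intro!: exI[of _ "{z. n \<bullet> z = 0}"] proj_line_hyperplane)
    (auto simp: span_singleton)

lemma proj_concurrent_hyperplanes:
  assumes "l \<noteq> 0" "m \<noteq> 0" "n \<noteq> 0" "x \<noteq> 0" "l \<bullet> x = 0" "m \<bullet> x = 0" "n \<bullet> x = 0"
  shows "proj_concurrent {z. l \<bullet> z = 0} {z. m \<bullet> z = 0} {z. n \<bullet> z = 0}"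
  unfolding proj_concurrent_def using assms
  by (auto intro!: exI[of _ "span {x}"] proj_line_hyperplane proj_point_span
      simp: span_singleton)

section \<open>Dual conics: a form \<open>D\<close> on lines and its inverse \<open>E\<close> on
  points\<close>

lemma invertibleE:
  fixes A :: "real^'n^'n"
  assumes "invertible A"
  obtains B where "A ** B = mat 1" "B ** A = mat 1"
  using assms by (auto simp: invertible_def)

context
  fixes D E :: "real^3^3"
  assumes sym: "transpose D = D" and DE: "D ** E = mat 1" and ED: "E ** D = mat 1"
begin

lemma inverse_matrix_mult_vector: "E *v (D *v n) = n"
  by (simp add: matrix_vector_mul_assoc ED)

lemma transpose_inverse_matrix: "transpose E = E"
proof -
  have "transpose E = transpose E ** (D ** E)"
    by (simp add: DE)
  also have "\<dots> = transpose (D ** E) ** E"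
    by (simp add: matrix_transpose_mul sym matrix_mul_assoc)
  finally show ?thesis
    by (simp add: DE transpose_mat)
qed

text \<open>Since \<open>E\<close> undoes \<open>D\<close>, the value of \<open>E\<close> at
  \<open>D *v n\<close> is that of \<open>D\<close> at \<open>n\<close>, and \<open>D *v n\<close>
  is nonzero. This point will be the point of contact.\<close>

lemma span_in_conic_points_inverse:
  assumes "n \<noteq> 0" "n \<bullet> (D *v n) = 0"
  shows "span {D *v n} \<in> conic_points E"
  using assms inverse_matrix_mult_vector[of n]
  by (intro span_in_conic_points) (auto simp: inner_commute)

lemma conic_matrix_inverse:
  assumes "n \<noteq> 0" "n \<bullet> (D *v n) = 0"
  shows "conic_matrix E"
  unfolding conic_matrix_def
  using transpose_inverse_matrix span_in_conic_points_inverse[OF assms] DE ED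
  by (auto simp: invertible_def)

text \<open>The contact point is \<open>D *v n\<close>: by symmetry of \<open>E\<close>, its tangent
  is the line with normal \<open>E *v (D *v n)\<close>, which is \<open>n\<close>.\<close>

lemma hyperplane_tangent_to_inverse:
  assumes "n \<noteq> 0" "n \<bullet> (D *v n) = 0"
  shows "tangent_to_conic {z. n \<bullet> z = 0} E"
proof -
  have "(D *v n) \<bullet> (E *v v) = n \<bullet> v" for v
    by (metis inner_transpose_matrix inverse_matrix_mult_vector transpose_inverse_matrix)
  then show ?thesis
    unfolding tangent_to_conic_def
    by (intro bexI[OF _ span_in_conic_points_inverse[OF assms]]) (simp add: tangent_line_at_span)
qed

end

section \<open>Projective transformations\<close>

context
  fixes T S :: "real^3^3"
  assumes TS: "T ** S = mat 1" and ST: "S ** T = mat 1"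
begin

lemma S_T: "S *v (T *v x) = x"
  by (simp add: matrix_vector_mul_assoc ST)

lemma T_S: "T *v (S *v x) = x"
  by (simp add: matrix_vector_mul_assoc TS)

lemma inj_T: "inj ((*v) T)"
  by (metis injI S_T)

lemma dim_image_T: "dim ((*v) T ` p) = dim p"
  by (rule dim_image_eq) (auto intro: inj_on_subset[OF inj_T])

lemma proj_point_image: "proj_point p \<Longrightarrow> proj_point ((*v) T ` p)"
  unfolding proj_point_def by (simp add: dim_image_T linear_subspace_image)

lemma proj_line_image: "proj_line p \<Longrightarrow> proj_line ((*v) T ` p)"
  unfolding proj_line_def by (simp add: dim_image_T linear_subspace_image)

lemma line_through_image: "line_through ((*v) T ` p) ((*v) T ` q) = (*v) T ` line_through p q"
  unfolding line_through_def by (simp add: linear_span_image flip: image_Un)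

lemma proj_collinear_image:
  "proj_collinear p q r \<Longrightarrow> proj_collinear ((*v) T ` p) ((*v) T ` q) ((*v) T ` r)"
  unfolding proj_collinear_def by (meson image_mono proj_line_image proj_point_image)

lemma proj_concurrent_image:
  "proj_concurrent p q r \<Longrightarrow> proj_concurrent ((*v) T ` p) ((*v) T ` q) ((*v) T ` r)"
  unfolding proj_concurrent_def by (meson image_mono proj_line_image proj_point_image)

text \<open>Points move by \<open>T\<close>, so a quadratic form moves by the inverse
  \<open>S\<close> on both sides; values at corresponding vectors then agree.\<close>

abbreviation (input) pushforward :: "real^3^3 \<Rightarrow> real^3^3"
  where "pushforward A \<equiv> transpose S ** A ** S"

lemma inner_pushforward: "(T *v x) \<bullet> (pushforward A *v (T *v y)) = x \<bullet> (A *v y)"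
proof -
  have "(T *v x) \<bullet> (pushforward A *v (T *v y)) = (T *v x) \<bullet> (transpose S *v (A *v y))"
    by (simp add: S_T flip: matrix_vector_mul_assoc)
  also have "\<dots> = (S *v (T *v x)) \<bullet> (A *v y)"
    by (metis inner_transpose_matrix inner_commute)
  finally show ?thesis
    by (simp add: S_T)
qed

lemma conic_points_pushforward: "p \<in> conic_points A \<Longrightarrow> (*v) T ` p \<in> conic_points (pushforward A)"
  by (auto simp: conic_points_def proj_point_image inner_pushforward)

lemma conic_matrix_pushforward: "conic_matrix A \<Longrightarrow> conic_matrix (pushforward A)"
  unfolding conic_matrix_def
proof (intro conjI; elim conjE)
  assume A: "transpose A = A" "invertible A" "conic_points A \<noteq> {}"
  show "transpose (pushforward A) = pushforward A"
    by (simp add: matrix_transpose_mul A matrix_mul_assoc)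
  have "invertible S"
    using TS ST by (auto simp: invertible_def)
  then show "invertible (pushforward A)"
    by (simp add: invertible_mult A transpose_invertible)
  show "conic_points (pushforward A) \<noteq> {}"
    using A(3) conic_points_pushforward by blast
qed

text \<open>The contact point moves along with the line. Equality of the lines, not just inclusion,
  comes from pulling vectors back by \<open>S\<close>.\<close>

lemma tangent_to_conic_pushforward:
  assumes "tangent_to_conic l A"
  shows "tangent_to_conic ((*v) T ` l) (pushforward A)"
proof -
  obtain p where p: "p \<in> conic_points A" "l = tangent_line_at A p"
    using assms by (auto simp: tangent_to_conic_def)
  have "(*v) T ` l = tangent_line_at (pushforward A) ((*v) T ` p)"
  proof
    show "(*v) T ` l \<subseteq> tangent_line_at (pushforward A) ((*v) T ` p)"
      by (auto simp: p tangent_line_at_def inner_pushforward)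
    show "tangent_line_at (pushforward A) ((*v) T ` p) \<subseteq> (*v) T ` l"
    proof
      fix y assume y: "y \<in> tangent_line_at (pushforward A) ((*v) T ` p)"
      then have "S *v y \<in> l"
        using inner_pushforward[of _ A "S *v y"] by (auto simp: p tangent_line_at_def T_S)
      then show "y \<in> (*v) T ` l"
        by (rule rev_image_eqI) (simp add: T_S)
    qed
  qed
  then show ?thesis
    using p conic_points_pushforward by (auto simp: tangent_to_conic_def)
qed

end

section \<open>The two conics and the configuration in barycentric coordinates\<close>

text \<open>
  \<open>D\<close> is the dual conic, a quadratic form on lines. After extracting the factor \<open>a * b * c\<close> from its
  determinant, what remains factors because of the identity named \<open>key\<close> in the proof.
\<close>

lemma hexagon_inconic:
  fixes u v w :: real
  defines "a \<equiv> v * w - u" and "b \<equiv> u * w - v" and "c \<equiv> u * v - w" and "s \<equiv> u * v * w + 1"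
  defines "D \<equiv> vector
    [vector [- 2 * a * v * w * (u\<^sup>2 - 1), s * a * b, s * a * c],
     vector [s * a * b, - 2 * b * u * w * (v\<^sup>2 - 1), s * b * c],
     vector [s * a * c, s * b * c, - 2 * c * u * v * (w\<^sup>2 - 1)]] :: real^3^3"
  shows "transpose D = D"
    and "det D = 2 * a * b * c * (u * v * w - 1)\<^sup>2 * (u * v * w) * ((u\<^sup>2 - 1) * (v\<^sup>2 - 1) * (w\<^sup>2 - 1))"
    and "vector [w, 1, v * w] \<bullet> (D *v vector [w, 1, v * w]) = 0"
    and "vector [u * w, u, 1] \<bullet> (D *v vector [u * w, u, 1]) = 0"
    and "vector [1, u * v, v] \<bullet> (D *v vector [1, u * v, v]) = 0"
    and "vector [1, w, u * w] \<bullet> (D *v vector [1, w, u * w]) = 0"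
    and "vector [u * v, 1, u] \<bullet> (D *v vector [u * v, 1, u]) = 0"
    and "vector [v, v * w, 1] \<bullet> (D *v vector [v, v * w, 1]) = 0"
proof -
  show "transpose D = D"
    by (simp add: D_def transpose_def vec_eq_iff forall_3)
  define A B C where "A = v * w * (u\<^sup>2 - 1)" and "B = u * w * (v\<^sup>2 - 1)" and "C = u * v * (w\<^sup>2 - 1)"
  define k where "k = u * v * w"
  define d where "d = (u\<^sup>2 - 1) * (v\<^sup>2 - 1) * (w\<^sup>2 - 1)"
  have key: "s * (a * b * c) + A * (b * c) + B * (a * c) + C * (a * b) = k * d"
    by (simp add: a_def b_def c_def s_def A_def B_def C_def k_def d_def algebra_simps power2_eq_square)
  have ABC: "A * B * C = k\<^sup>2 * d"
    by (simp add: A_def B_def C_def k_def d_def power2_eq_square)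
  have "det D = det (vector [vector [- 2 * a * A, s * a * b, s * a * c],
     vector [s * a * b, - 2 * b * B, s * b * c],
     vector [s * a * c, s * b * c, - 2 * c * C]] :: real^3^3)"
    by (simp add: D_def A_def B_def C_def mult.assoc)
  also have "\<dots> = 2 * a * b * c * (s\<^sup>2 * (s * (a * b * c) + A * (b * c) + B * (a * c) + C * (a * b))
      - 4 * (A * B * C))"
    by (simp add: det_3 algebra_simps power2_eq_square)
  \<comment> \<open>Here \<open>s = k + 1\<close>, so the remaining factor
    \<open>s\<^sup>2 - 4 * k\<close> is the square of \<open>k - 1\<close>.\<close>
  also have "\<dots> = 2 * a * b * c * (k - 1)\<^sup>2 * k * d"
    unfolding key ABC by (simp add: s_def flip: k_def) (simp add: algebra_simps power2_eq_square)
  finally show "det D = 2 * a * b * c * (u * v * w - 1)\<^sup>2 * (u * v * w) * ((u\<^sup>2 - 1) * (v\<^sup>2 - 1) * (w\<^sup>2 - 1))"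
    by (simp add: k_def d_def)
qed (simp_all add: D_def vector_3_simps a_def b_def c_def s_def algebra_simps power2_eq_square)

text \<open>
  On the side line \<open>z = 0\<close> the two points \<open>(-1, w, 0)\<close> and \<open>(w, -1, 0)\<close> are cut out by
  \<open>x\<^sup>2 + (w + 1 / w) * x * y + y\<^sup>2\<close>, and similarly on the other two; these three forms glue to one.
\<close>

lemma hexagon_circumconic:
  fixes u v w :: real
  defines "A \<equiv> vector
    [vector [2 * u * v * w, u * v * (w\<^sup>2 + 1), u * w * (v\<^sup>2 + 1)],
     vector [u * v * (w\<^sup>2 + 1), 2 * u * v * w, v * w * (u\<^sup>2 + 1)],
     vector [u * w * (v\<^sup>2 + 1), v * w * (u\<^sup>2 + 1), 2 * u * v * w]] :: real^3^3"
  shows "transpose A = A"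
    and "det A = 2 * (u * v * w) * (u * v * w - 1) * (v * w - u) * (u * w - v) * (u * v - w)"
    and "vector [v, 0, -1] \<bullet> (A *v vector [v, 0, -1]) = 0"
    and "vector [-1, w, 0] \<bullet> (A *v vector [-1, w, 0]) = 0"
    and "vector [0, -1, u] \<bullet> (A *v vector [0, -1, u]) = 0"
    and "vector [w, -1, 0] \<bullet> (A *v vector [w, -1, 0]) = 0"
    and "vector [0, u, -1] \<bullet> (A *v vector [0, u, -1]) = 0"
    and "vector [-1, 0, v] \<bullet> (A *v vector [-1, 0, v]) = 0"
proof -
  show "transpose A = A"
    by (simp add: A_def transpose_def vec_eq_iff forall_3)
  show "det A = 2 * (u * v * w) * (u * v * w - 1) * (v * w - u) * (u * w - v) * (u * v - w)"
    unfolding A_def by (simp add: det_3 algebra_simps power2_eq_square)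
qed (simp_all add: A_def vector_3_simps algebra_simps power2_eq_square)

text \<open>The full statement for the reference triangle. The lengths of the sides and the triangle
  inequality enter only through the six inequalities on \<open>u\<close>, \<open>v\<close>,
  \<open>w\<close>.\<close>

lemma barycentric_configuration:
  fixes u v w :: real
  assumes "u > 1" "v > 1" "w > 1" "u < v * w" "v < u * w" "w < u * v"
  defines "p1 \<equiv> span {vector [1, 0, 0] :: real^3}" and "p2 \<equiv> span {vector [0, 1, 0] :: real^3}"
    and "p3 \<equiv> span {vector [0, 0, 1] :: real^3}"
    and "q1 \<equiv> span {vector [v, 0, -1]}" and "q2 \<equiv> span {vector [-1, w, 0]}"
    and "q3 \<equiv> span {vector [0, -1, u]}"
    and "r1 \<equiv> span {vector [w, -1, 0]}" and "r2 \<equiv> span {vector [0, u, -1]}"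
    and "r3 \<equiv> span {vector [-1, 0, v]}"
  defines "L1 \<equiv> line_through r1 r2 \<inter> line_through q3 q1"
    and "L2 \<equiv> line_through r2 r3 \<inter> line_through q1 q2"
    and "L3 \<equiv> line_through r3 r1 \<inter> line_through q2 q3"
    and "M1 \<equiv> line_through r2 r3 \<inter> line_through q2 q3"
    and "M2 \<equiv> line_through r3 r1 \<inter> line_through q3 q1"
    and "M3 \<equiv> line_through r1 r2 \<inter> line_through q1 q2"
  shows "\<exists>A. conic_matrix A \<and> {q1, q2, q3, r1, r2, r3} \<subseteq> conic_points A"
    and "\<exists>B. conic_matrix B \<and>
      (\<forall>l \<in> {line_through q1 q2, line_through q2 q3, line_through q3 q1,
              line_through r1 r2, line_through r2 r3, line_through r3 r1}. tangent_to_conic l B)"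
    and "proj_collinear L1 p1 M1" and "proj_collinear L2 p2 M2" and "proj_collinear L3 p3 M3"
    and "proj_concurrent (line_through L1 p1) (line_through L2 p2) (line_through L3 p3)"
proof -
  define a b c where "a = v * w - u" and "b = u * w - v" and "c = u * v - w"
  have abc: "a > 0" "b > 0" "c > 0"
    using assms by (auto simp: a_def b_def c_def)
  have sq: "u\<^sup>2 - 1 > 0" "v\<^sup>2 - 1 > 0" "w\<^sup>2 - 1 > 0"
    using assms by (auto simp: one_less_power)
  have uvw: "u * v * w > 1"
    using assms by (simp add: less_1_mult)
  have pos: "u > 0" "v > 0" "w > 0"
    using assms by auto
  have ineq: "a \<noteq> 0" "b \<noteq> 0" "c \<noteq> 0" "u\<^sup>2 - 1 \<noteq> 0" "v\<^sup>2 - 1 \<noteq> 0" "w\<^sup>2 - 1 \<noteq> 0" "u \<noteq> 0" "v \<noteq> 0" "w \<noteq> 0"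
    using abc sq pos by auto

  \<comment> \<open>These normals are the cross products of the vertex vectors, and exactly the six
    vectors on which the form of \<open>hexagon_inconic\<close> vanishes.\<close>
  have lines:
    "line_through q1 q2 = {z. vector [w, 1, v * w] \<bullet> z = 0}"
    "line_through q2 q3 = {z. vector [u * w, u, 1] \<bullet> z = 0}"
    "line_through q3 q1 = {z. vector [1, u * v, v] \<bullet> z = 0}"
    "line_through r1 r2 = {z. vector [1, w, u * w] \<bullet> z = 0}"
    "line_through r2 r3 = {z. vector [u * v, 1, u] \<bullet> z = 0}"
    "line_through r3 r1 = {z. vector [v, v * w, 1] \<bullet> z = 0}"
    unfolding q1_def q2_def q3_def r1_def r2_def r3_def
    by (subst line_through_span_pair; simp add: vector_3_simps mult.commute)+

  have L: "L1 = span {vector [- w * v * (u\<^sup>2 - 1), b, c]}"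
    "L2 = span {vector [a, - u * w * (v\<^sup>2 - 1), c]}"
    "L3 = span {vector [a, b, - u * v * (w\<^sup>2 - 1)]}"
    unfolding L1_def L2_def L3_def lines using ineq
    by (subst hyperplane_Int_eq_span_cross3;
        simp add: vector_3_simps a_def b_def c_def algebra_simps power2_eq_square)+

  have M: "M1 = span {vector [- (u\<^sup>2 - 1), u * b, u * c]}"
    "M2 = span {vector [v * a, - (v\<^sup>2 - 1), v * c]}"
    "M3 = span {vector [w * a, w * b, - (w\<^sup>2 - 1)]}"
    unfolding M1_def M2_def M3_def lines using ineq
    by (subst hyperplane_Int_eq_span_cross3;
        simp add: vector_3_simps a_def b_def c_def algebra_simps power2_eq_square)+

  \<comment> \<open>The last two coordinates of both \<open>L1\<close> and \<open>M1\<close> are in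
    the ratio \<open>b : c\<close>, so both lie on the line joining \<open>p1\<close> to
    \<open>(a, b, c)\<close>, whose normal is \<open>(0, c, -b)\<close>. The other two cases are
    cyclic.\<close>
  show "proj_collinear L1 p1 M1"
    unfolding L M p1_def using ineq
    by (intro proj_collinear_span[where n = "vector [0, c, - b]"]) (auto simp: vector_3_simps)
  show "proj_collinear L2 p2 M2"
    unfolding L M p2_def using ineq
    by (intro proj_collinear_span[where n = "vector [- c, 0, a]"]) (auto simp: vector_3_simps)
  show "proj_collinear L3 p3 M3"
    unfolding L M p3_def using ineq
    by (intro proj_collinear_span[where n = "vector [b, - a, 0]"]) (auto simp: vector_3_simps)

  have LP: "line_through L1 p1 = {z. vector [0, c, - b] \<bullet> z = 0}"
    "line_through L2 p2 = {z. vector [- c, 0, a] \<bullet> z = 0}"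
    "line_through L3 p3 = {z. vector [b, - a, 0] \<bullet> z = 0}"
    unfolding L p1_def p2_def p3_def using ineq
    by (subst line_through_span_pair; simp add: vector_3_simps)+
  show "proj_concurrent (line_through L1 p1) (line_through L2 p2) (line_through L3 p3)"
    unfolding LP using ineq
    by (intro proj_concurrent_hyperplanes[where x = "vector [a, b, c]"]) (auto simp: vector_3_simps)

  obtain A :: "real^3^3" where A_sym: "transpose A = A"
    and A_det: "det A = 2 * (u * v * w) * (u * v * w - 1) * a * b * c"
    and A: "vector [v, 0, -1] \<bullet> (A *v vector [v, 0, -1]) = 0"
      "vector [-1, w, 0] \<bullet> (A *v vector [-1, w, 0]) = 0"
      "vector [0, -1, u] \<bullet> (A *v vector [0, -1, u]) = 0"
      "vector [w, -1, 0] \<bullet> (A *v vector [w, -1, 0]) = 0"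
      "vector [0, u, -1] \<bullet> (A *v vector [0, u, -1]) = 0"
      "vector [-1, 0, v] \<bullet> (A *v vector [-1, 0, v]) = 0"
    using hexagon_circumconic[where u = u and v = v and w = w] unfolding a_def b_def c_def by blast
  have on_A: "{q1, q2, q3, r1, r2, r3} \<subseteq> conic_points A"
    using A unfolding q1_def q2_def q3_def r1_def r2_def r3_def
    by (auto intro!: span_in_conic_points simp: vector_3_eq_0_iff)
  \<comment> \<open>The factor \<open>u * v * w - 1\<close> of the determinant is nonzero by
    \<open>uvw\<close>, the other factors by \<open>ineq\<close>.\<close>
  have "invertible A"
    using A_det uvw ineq by (simp add: invertible_det_nz)
  with A_sym on_A show "\<exists>A. conic_matrix A \<and> {q1, q2, q3, r1, r2, r3} \<subseteq> conic_points A"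
    unfolding conic_matrix_def by blast

  obtain D :: "real^3^3" where D_sym: "transpose D = D"
    and D_det: "det D = 2 * a * b * c * (u * v * w - 1)\<^sup>2 * (u * v * w) *
      ((u\<^sup>2 - 1) * (v\<^sup>2 - 1) * (w\<^sup>2 - 1))"
    and D: "vector [w, 1, v * w] \<bullet> (D *v vector [w, 1, v * w]) = 0"
      "vector [u * w, u, 1] \<bullet> (D *v vector [u * w, u, 1]) = 0"
      "vector [1, u * v, v] \<bullet> (D *v vector [1, u * v, v]) = 0"
      "vector [1, w, u * w] \<bullet> (D *v vector [1, w, u * w]) = 0"
      "vector [u * v, 1, u] \<bullet> (D *v vector [u * v, 1, u]) = 0"
      "vector [v, v * w, 1] \<bullet> (D *v vector [v, v * w, 1]) = 0"
    using hexagon_inconic[where u = u and v = v and w = w] unfolding a_def b_def c_def by blast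
  have "invertible D"
    using D_det uvw ineq by (simp add: invertible_det_nz)
  \<comment> \<open>\<open>D\<close> is a form on lines; the conic touched by the six lines is its
    inverse.\<close>
  then obtain E where DE: "D ** E = mat 1" "E ** D = mat 1"
    by (rule invertibleE)
  \<comment> \<open>The real point required of a conic is the point of contact with the line
    \<open>q1 q2\<close>, obtained from \<open>D(1)\<close>.\<close>
  have "conic_matrix E"
    by (rule conic_matrix_inverse[OF D_sym DE _ D(1)]) (simp add: vector_3_eq_0_iff)
  moreover have "tangent_to_conic l E"
    if "l \<in> {line_through q1 q2, line_through q2 q3, line_through q3 q1,
              line_through r1 r2, line_through r2 r3, line_through r3 r1}" for l
    using that D unfolding lines
    by (auto intro!: hyperplane_tangent_to_inverse[OF D_sym DE] simp: vector_3_eq_0_iff)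
  ultimately show "\<exists>B. conic_matrix B \<and>
      (\<forall>l \<in> {line_through q1 q2, line_through q2 q3, line_through q3 q1,
              line_through r1 r2, line_through r2 r3, line_through r3 r1}. tangent_to_conic l B)"
    by blast
qed

section \<open>From the Euclidean triangle to barycentric coordinates\<close>

lemma span_singleton_scaleR: "k \<noteq> 0 \<Longrightarrow> span {k *\<^sub>R x} = span {x :: 'a::real_vector}"
  unfolding span_eq using span_scale[of "k *\<^sub>R x" "{k *\<^sub>R x}" "inverse k"]
  by (simp add: span_scale span_base)

text \<open>Scaling the homogeneous coordinates of the extended point by \<open>d / t\<close> leaves
  \<open>1 + d / t\<close> times \<open>x\<close> minus \<open>y\<close>. This is the origin of the
  parameters \<open>u\<close>, \<open>v\<close>, \<open>w\<close> and of the entries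
  \<open>-1\<close>.\<close>

lemma proj_of_extension:
  assumes "t > 0" "d > 0"
  shows "proj_of (x + (t / d) *\<^sub>R (x - y)) =
    span {(1 + d / t) *\<^sub>R vector [x $ 1, x $ 2, 1] - vector [y $ 1, y $ 2, 1]}"
proof -
  have "(1 + d / t) *\<^sub>R vector [x $ 1, x $ 2, 1] - vector [y $ 1, y $ 2, 1] =
    (d / t) *\<^sub>R (vector [(x + (t / d) *\<^sub>R (x - y)) $ 1, (x + (t / d) *\<^sub>R (x - y)) $ 2, 1] :: real^3)"
    using assms by (simp add: vec_eq_iff forall_3 field_simps)
  then show ?thesis
    using assms by (simp add: proj_of_def span_singleton_scaleR)
qed

text \<open>For \<open>x \<noteq> y\<close>, the vanishing determinant makes \<open>z - y\<close>
  equal to its orthogonal projection onto \<open>x - y\<close>, which supplies the scalar.\<close>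

lemma collinear_vec2_if_det_eq_0:
  fixes x y z :: "real^2"
  assumes "(x$1 - y$1) * (z$2 - y$2) = (x$2 - y$2) * (z$1 - y$1)"
  shows "collinear {x, y, z}"
proof -
  have "z - y = ((x - y) \<bullet> (z - y) / ((x - y) \<bullet> (x - y))) *\<^sub>R (x - y)" if "x - y \<noteq> 0"
  proof -
    have "((x - y) \<bullet> (x - y)) *\<^sub>R (z - y) = ((x - y) \<bullet> (z - y)) *\<^sub>R (x - y)"
      using assms by (simp add: vec_eq_iff forall_2 inner_vec_def sum_2; algebra)
    then show ?thesis
      using that by (simp add: eq_vector_fraction_iff)
  qed
  then show ?thesis
    by (subst collinear_3) (auto simp: collinear_lemma)
qed

text \<open>Equality would place \<open>y\<close> between \<open>x\<close> and
  \<open>z\<close>.\<close>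

lemma strict_triangle_inequality:
  fixes x y z :: "'a::euclidean_space"
  assumes "\<not> collinear {x, y, z}"
  shows "dist x z < dist x y + dist y z"
  using assms between_imp_collinear[of x z y] between[of x z y] dist_triangle[of x z y]
  by fastforce

lemma cycle_3: "(1 :: 3) - 1 = 3" "(2 :: 3) - 1 = 1" "(3 :: 3) - 1 = 2"
  "(1 :: 3) + 1 = 2" "(2 :: 3) + 1 = 3" "(3 :: 3) + 1 = 1"
  by simp_all

theorem theorem2:
  fixes t :: real and P :: "3 \<Rightarrow> real^2"
    and p q r :: "3 \<Rightarrow> (real^3) set"
    and L1 L2 L3 M1 M2 M3 :: "(real^3) set"
  assumes "t > 0"
    and "\<not> collinear {P 1, P 2, P 3}"
    and "p = (\<lambda>i. proj_of (P i))"
    and "q = (\<lambda>i. proj_of (q_map t P i))"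
    and "r = (\<lambda>i. proj_of (r_map t P i))"
    and "L1 = line_through (r 1) (r 2) \<inter> line_through (q 3) (q 1)"
    and "L2 = line_through (r 2) (r 3) \<inter> line_through (q 1) (q 2)"
    and "L3 = line_through (r 3) (r 1) \<inter> line_through (q 2) (q 3)"
    and "M1 = line_through (r 2) (r 3) \<inter> line_through (q 2) (q 3)"
    and "M2 = line_through (r 3) (r 1) \<inter> line_through (q 3) (q 1)"
    and "M3 = line_through (r 1) (r 2) \<inter> line_through (q 1) (q 2)"
  shows "(\<exists>A. conic_matrix A \<and> {q 1, q 2, q 3, r 1, r 2, r 3} \<subseteq> conic_points A) \<and>
    (\<exists>B. conic_matrix B \<and>
      (\<forall>l \<in> {line_through (q 1) (q 2), line_through (q 2) (q 3), line_through (q 3) (q 1),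
              line_through (r 1) (r 2), line_through (r 2) (r 3), line_through (r 3) (r 1)}.
        tangent_to_conic l B)) \<and>
    proj_collinear L1 (p 1) M1 \<and> proj_collinear L2 (p 2) M2 \<and> proj_collinear L3 (p 3) M3 \<and>
    proj_concurrent (line_through L1 (p 1)) (line_through L2 (p 2)) (line_through L3 (p 3))"
proof -
  \<comment> \<open>Each length belongs to the side opposite the vertex of the same position:
    \<open>a\<close> faces \<open>P 1\<close>, \<open>b\<close> faces \<open>P 2\<close>,
    \<open>c\<close> faces \<open>P 3\<close>.\<close>
  define a b c where "a = dist (P 2) (P 3)" and "b = dist (P 3) (P 1)" and "c = dist (P 1) (P 2)"
  define u v w where "u = 1 + a / t" and "v = 1 + b / t" and "w = 1 + c / t"
  have perm: "\<not> collinear {P 2, P 3, P 1}" "\<not> collinear {P 3, P 1, P 2}"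
    using assms(2) by (simp_all add: insert_commute)
  then have pos: "a > 0" "b > 0" "c > 0"
    using assms(2) by (auto simp: a_def b_def c_def insert_commute)
  have "b < c + a" "c < a + b" "a < b + c"
    using strict_triangle_inequality[OF assms(2)] strict_triangle_inequality[OF perm(1)]
      strict_triangle_inequality[OF perm(2)]
    by (simp_all add: a_def b_def c_def dist_commute)
  then have tri: "b / t < c / t + a / t" "c / t < a / t + b / t" "a / t < b / t + c / t"
    using \<open>t > 0\<close> by (simp_all add: divide_strict_right_mono flip: add_divide_distrib)
  have uvw: "u > 1" "v > 1" "w > 1"
    using pos \<open>t > 0\<close> by (simp_all add: u_def v_def w_def)
  \<comment> \<open>Expanding, \<open>v * w\<close> is \<open>1 + b / t + c / t\<close> plus the
    product of the two quotients; its positivity and the triangle inequality give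
    \<open>u < v * w\<close>, and likewise for the others.\<close>
  have "a / t * (b / t) > 0" "b / t * (c / t) > 0" "a / t * (c / t) > 0"
    using pos \<open>t > 0\<close> by simp_all
  then have ineq: "u < v * w" "v < u * w" "w < u * v"
    using tri unfolding u_def v_def w_def distrib_left distrib_right mult_1 mult_1_right
    by linarith+
  note bary = barycentric_configuration[OF uvw ineq]

  \<comment> \<open>\<open>T\<close> sends barycentric to homogeneous Cartesian coordinates.\<close>
  define T where "T = (vector [vector [P 1 $ 1, P 2 $ 1, P 3 $ 1],
    vector [P 1 $ 2, P 2 $ 2, P 3 $ 2], vector [1, 1, 1]] :: real^3^3)"
  \<comment> \<open>Up to sign, \<open>det T\<close> is twice the area of the triangle.\<close>
  have "det T \<noteq> 0"
  proof
    assume "det T = 0"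
    then have "collinear {P 1, P 2, P 3}"
      by (intro collinear_vec2_if_det_eq_0) (simp add: T_def det_3 algebra_simps)
    with assms(2) show False ..
  qed
  then obtain S where TS: "T ** S = mat 1" and ST: "S ** T = mat 1"
    by (metis invertible_det_nz invertibleE)
  \<comment> \<open>\<open>f\<close> commutes with spans, joins and, being induced by an injective
    map, intersections. Unfolding therefore presents every object of the goal as the image under
    \<open>f\<close> of its barycentric counterpart.\<close>
  define f where "f = (`) ((*v) T)"
  have f_span: "f (span {x}) = span {T *v x}" for x
    by (simp add: f_def flip: linear_span_image)
  have f_Int: "f x \<inter> f y = f (x \<inter> y)" for x y
    by (simp add: f_def image_Int inj_T[OF TS ST])
  have f_line: "line_through (f x) (f y) = f (line_through x y)" for x y
    by (simp add: f_def line_through_image[OF TS ST])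

  have norms: "norm (P 1 - P 3) = b" "norm (P 2 - P 1) = c" "norm (P 3 - P 2) = a"
    "norm (P 1 - P 2) = c" "norm (P 2 - P 3) = a" "norm (P 3 - P 1) = b"
    by (simp_all add: a_def b_def c_def dist_norm norm_minus_commute)
  have p: "p 1 = f (span {vector [1, 0, 0]})" "p 2 = f (span {vector [0, 1, 0]})"
    "p 3 = f (span {vector [0, 0, 1]})"
    by (simp_all add: assms(3) f_span proj_of_def T_def vector_3_simps)
  \<comment> \<open>By \<open>proj_of_extension\<close> and \<open>f_span\<close> both sides are
    spans of single vectors, which then agree coordinatewise.\<close>
  have q: "q 1 = f (span {vector [v, 0, -1]})" "q 2 = f (span {vector [-1, w, 0]})"
    "q 3 = f (span {vector [0, -1, u]})"
    by (simp_all only: assms(4) q_map_def cycle_3 norms f_span proj_of_extension[OF \<open>t > 0\<close>] pos)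
      (simp_all add: T_def vector_3_simps algebra_simps u_def v_def w_def)
  have r: "r 1 = f (span {vector [w, -1, 0]})" "r 2 = f (span {vector [0, u, -1]})"
    "r 3 = f (span {vector [-1, 0, v]})"
    by (simp_all only: assms(5) r_map_def cycle_3 norms f_span proj_of_extension[OF \<open>t > 0\<close>] pos)
      (simp_all add: T_def vector_3_simps algebra_simps u_def v_def w_def)

  show ?thesis
    unfolding assms(6-11) p q r f_line f_Int
  proof (intro conjI)
    obtain A where A: "conic_matrix A"
      "{span {vector [v, 0, -1]}, span {vector [-1, w, 0]}, span {vector [0, -1, u]},
        span {vector [w, -1, 0]}, span {vector [0, u, -1]}, span {vector [-1, 0, v]}} \<subseteq> conic_points A"
      using bary(1) by blast
    show "\<exists>A. conic_matrix A \<and> {f (span {vector [v, 0, -1]}), f (span {vector [-1, w, 0]}),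
        f (span {vector [0, -1, u]}), f (span {vector [w, -1, 0]}), f (span {vector [0, u, -1]}),
        f (span {vector [-1, 0, v]})} \<subseteq> conic_points A"
      using A conic_matrix_pushforward[OF TS ST] conic_points_pushforward[OF TS ST]
      unfolding f_def by (intro exI[of _ "transpose S ** A ** S"]) simp
  next
    show "\<exists>B. conic_matrix B \<and>
      (\<forall>l \<in> {f (line_through (span {vector [v, 0, -1]}) (span {vector [-1, w, 0]})),
             f (line_through (span {vector [-1, w, 0]}) (span {vector [0, -1, u]})),
             f (line_through (span {vector [0, -1, u]}) (span {vector [v, 0, -1]})),
             f (line_through (span {vector [w, -1, 0]}) (span {vector [0, u, -1]})),
             f (line_through (span {vector [0, u, -1]}) (span {vector [-1, 0, v]})),
             f (line_through (span {vector [-1, 0, v]}) (span {vector [w, -1, 0]}))}.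
        tangent_to_conic l B)"
      using bary(2) conic_matrix_pushforward[OF TS ST] tangent_to_conic_pushforward[OF TS ST]
      unfolding f_def by fastforce
  qed (use bary proj_collinear_image[OF TS ST] proj_concurrent_image[OF TS ST] in \<open>simp_all add: f_def\<close>)
qed

end
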